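(* Let $\mathcal{H}$ be a BRSC and let $1\le k\le 3$. Then $\mathrm{pure}(\mathcal{H}_k)$ is a TBRSC.
   Context: A simplicial complex is a pair $(V,H)$ with $V$ finite nonempty, $H\subseteq 2^V$ containing all singletons and closed under subsets; dimension is $\max\{|X|:X\in H\}-1$. A flat is a set $F\subseteq V$ with $X\cup\{p\}\in H$ for all $X\in H$, $X\subseteq F$, $p\in V\setminus F$. A complex is boolean representable (BRSC) if it admits a boolean matrix representation; equivalently, every face $\{x_1,\dots,x_k\}$ admits (for a suitable enumeration) a chain of flats $F_0\subset\cdots\subset F_k$ with $x_i\in F_i\setminus F_{i-1}$. The $k$-truncation is $\mathcal{H}_k=(V,H\cap P_{\le k}(V))$, where $P_{\le k}(V)$ is the set of subsets with at most $k$ elements. A TBRSC is a complex equal to the $m$-truncation of some BRSC for some $m\ge1$. For a complex $(V,H)$ of dimension $d$, $\mathrm{pure}(V,H)=(V',H')$ where $V'$ is the union of all faces with $d+1$ elements and $H'$ is the set of all subsets of faces with $d+1$ elements. *)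

theory Defs
  imports Main
begin

type_synonym 'a scomplex = "'a set \<times> 'a set set"

abbreviation vertices :: "'a scomplex \<Rightarrow> 'a set" where "vertices K \<equiv> fst K"
abbreviation faces :: "'a scomplex \<Rightarrow> 'a set set" where "faces K \<equiv> snd K"

definition simplicial_complex :: "'a scomplex \<Rightarrow> bool" where
  "simplicial_complex K \<longleftrightarrow>
     finite (vertices K) \<and> vertices K \<noteq> {} \<and> faces K \<subseteq> Pow (vertices K) \<and>
     (\<forall>v\<in>vertices K. {v} \<in> faces K) \<and>
     (\<forall>X\<in>faces K. \<forall>Y. Y \<subseteq> X \<longrightarrow> Y \<in> faces K)"

(* Truncated subtraction is harmless: a simplicial complex has a face with one element. *)
definition dimension :: "'a scomplex \<Rightarrow> nat" where
  "dimension K = Max (card ` faces K) - 1"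

definition flat :: "'a scomplex \<Rightarrow> 'a set \<Rightarrow> bool" where
  "flat K F \<longleftrightarrow>
     F \<subseteq> vertices K \<and>
     (\<forall>X\<in>faces K. X \<subseteq> F \<longrightarrow> (\<forall>p\<in>vertices K - F. X \<union> {p} \<in> faces K))"

definition lower_unitriangular :: "nat \<Rightarrow> (nat \<Rightarrow> nat \<Rightarrow> bool) \<Rightarrow> bool" where
  "lower_unitriangular n A \<longleftrightarrow>
     (\<forall>i<n. A i i) \<and> (\<forall>i<n. \<forall>j<n. i < j \<longrightarrow> \<not> A i j)"

(* The submatrix M[Y,X] is nonsingular over the superboolean semiring iff independent
   permutations of its rows and columns bring it into lower unitriangular form. *)
definition nonsingular_submatrix :: "('r \<Rightarrow> 'a \<Rightarrow> bool) \<Rightarrow> 'r set \<Rightarrow> 'a set \<Rightarrow> bool" where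
  "nonsingular_submatrix M Y X \<longleftrightarrow>
     (\<exists>n r c. bij_betw r {..<n} Y \<and> bij_betw c {..<n} X \<and>
              lower_unitriangular n (\<lambda>i j. M (r i) (c j)))"

definition independent_columns :: "'r set \<Rightarrow> ('r \<Rightarrow> 'a \<Rightarrow> bool) \<Rightarrow> 'a set \<Rightarrow> bool" where
  "independent_columns R M X \<longleftrightarrow> (\<exists>Y\<subseteq>R. nonsingular_submatrix M Y X)"

(* A boolean matrix with m rows and columns indexed by the vertex set is a function
   M :: nat \<Rightarrow> 'a \<Rightarrow> bool, read on {..<m} and the vertices only. *)
definition boolean_representable :: "'a scomplex \<Rightarrow> bool" where
  "boolean_representable K \<longleftrightarrow>
     (\<exists>m (M :: nat \<Rightarrow> 'a \<Rightarrow> bool).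
        faces K = {X. X \<subseteq> vertices K \<and> independent_columns {..<m} M X})"

definition BRSC :: "'a scomplex \<Rightarrow> bool" where
  "BRSC K \<longleftrightarrow> simplicial_complex K \<and> boolean_representable K"

definition truncation :: "nat \<Rightarrow> 'a scomplex \<Rightarrow> 'a scomplex" where
  "truncation k K = (vertices K, faces K \<inter> {X. X \<subseteq> vertices K \<and> card X \<le> k})"

definition TBRSC :: "'a scomplex \<Rightarrow> bool" where
  "TBRSC K \<longleftrightarrow> simplicial_complex K \<and> (\<exists>m\<ge>1. \<exists>B. BRSC B \<and> K = truncation m B)"

definition pure :: "'a scomplex \<Rightarrow> 'a scomplex" where
  "pure K =
     (let T = {X \<in> faces K. card X = dimension K + 1}
      in (\<Union>T, {Y. \<exists>X\<in>T. Y \<subseteq> X}))"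

lemma face_of_flat_chain_independent:
  fixes n :: nat
  assumes c: "bij_betw c {..<n} X" and empty: "{} \<in> faces K" and X: "X \<subseteq> vertices K"
    and Z: "\<And>i. i < n \<Longrightarrow> flat K (Z i)"
    and one: "\<And>i. i < n \<Longrightarrow> c i \<notin> Z i"
    and zero: "\<And>i j. i < j \<Longrightarrow> j < n \<Longrightarrow> c j \<in> Z i"
  shows "X \<in> faces K"
proof -
  have "c ` {n - k..<n} \<in> faces K" if "k \<le> n" for k
    using that
  proof (induction k)
    case 0
    then show ?case using empty by simp
  next
    case (Suc k)
    define i where "i = n - Suc k"
    have i: "i < n" "n - k = Suc i" using Suc.prems by (auto simp: i_def)
    have IH: "c ` {Suc i..<n} \<in> faces K" using Suc i by simp
    have "c ` {Suc i..<n} \<subseteq> Z i" using zero by auto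
    moreover have "c i \<in> vertices K - Z i"
      using one[OF i(1)] X c i(1) by (auto simp: bij_betw_def)
    ultimately have "c ` {Suc i..<n} \<union> {c i} \<in> faces K"
      using Z[OF i(1)] IH unfolding flat_def by blast
    moreover have "{i..<n} = insert i {Suc i..<n}" using i(1) by auto
    then have "c ` {Suc i..<n} \<union> {c i} = c ` {i..<n}"
      by simp
    ultimately show ?case by (simp add: i_def)
  qed
  from this[of n] c show ?thesis by (simp add: bij_betw_def lessThan_atLeast0)
qed

lemma flat_Int: "flat K F \<Longrightarrow> flat K G \<Longrightarrow> flat K (F \<inter> G)"
  by (simp add: flat_def) blast

lemma flat_vertices: "flat K (vertices K)"
  by (simp add: flat_def)

lemma flat_zero_columns:
  assumes K: "faces K = {X. X \<subseteq> vertices K \<and> independent_columns {..<m} M X}"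
    and s: "s < m"
  shows "flat K {v \<in> vertices K. \<not> M s v}"
  unfolding flat_def
proof (intro conjI ballI impI)
  fix X p
  assume X: "X \<in> faces K" "X \<subseteq> {v \<in> vertices K. \<not> M s v}"
    and p: "p \<in> vertices K - {v \<in> vertices K. \<not> M s v}"
  from X(1) K obtain Y n r c where Y: "Y \<subseteq> {..<m}" and r: "bij_betw r {..<n} Y"
    and c: "bij_betw c {..<n} X" and tri: "lower_unitriangular n (\<lambda>i j. M (r i) (c j))"
    by (auto simp: independent_columns_def nonsingular_submatrix_def)
  have Mp: "M s p" and pX: "p \<notin> X" using p X(2) by auto
  have sY: "s \<notin> Y"
  proof
    assume "s \<in> Y"
    then obtain i where i: "i < n" "s = r i" using r by (auto simp: bij_betw_def)
    have "M s (c i)" using tri i by (simp add: lower_unitriangular_def)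
    moreover have "c i \<in> X" using c i by (auto simp: bij_betw_def)
    ultimately show False using X(2) by auto
  qed
  define r' c' where "r' = case_nat s r" and "c' = case_nat p c"
  have split: "{..<Suc n} = insert 0 (Suc ` {..<n})"
    by (rule lessThan_Suc_eq_insert_0)
  have "bij_betw r' {..<Suc n} (insert s Y)" "bij_betw c' {..<Suc n} (insert p X)"
    using r c sY pX unfolding split bij_betw_def r'_def c'_def
    by (auto simp: inj_on_def image_image)
  moreover have "lower_unitriangular (Suc n) (\<lambda>i j. M (r' i) (c' j))"
    unfolding lower_unitriangular_def
  proof (intro conjI allI impI)
    fix i assume "i < Suc n"
    then show "M (r' i) (c' i)"
      using tri Mp by (cases i) (auto simp: r'_def c'_def lower_unitriangular_def)
  next
    fix i j assume ij: "i < Suc n" "j < Suc n" "i < j"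
    then obtain j' where j: "j = Suc j'" "j' < n" by (cases j) auto
    have "c j' \<in> X" using c j by (auto simp: bij_betw_def)
    then show "\<not> M (r' i) (c' j)"
      using tri X(2) ij j by (cases i) (auto simp: r'_def c'_def lower_unitriangular_def)
  qed
  ultimately have "nonsingular_submatrix M (insert s Y) (insert p X)"
    unfolding nonsingular_submatrix_def by (intro exI conjI)
  moreover have "insert s Y \<subseteq> {..<m}" using Y s by simp
  ultimately have "independent_columns {..<m} M (insert p X)"
    unfolding independent_columns_def by (intro exI conjI)
  then show "X \<union> {p} \<in> faces K" using K X(2) p by auto
qed auto

theorem BRSC_iff_chains_of_flats:
  "BRSC K \<longleftrightarrow> simplicial_complex K \<and>
     (\<forall>X\<in>faces K. \<exists>(k::nat) x F. bij_betw x {1..k} X \<and> (\<forall>i\<le>k. flat K (F i)) \<and>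
        (\<forall>i\<in>{1..k}. F (i - 1) \<subset> F i \<and> x i \<in> F i - F (i - 1)))"
  (is "_ \<longleftrightarrow> _ \<and> (\<forall>X\<in>faces K. ?chain X)")
proof
  assume "BRSC K"
  then obtain m and M :: "nat \<Rightarrow> 'a \<Rightarrow> bool" where sc: "simplicial_complex K"
    and K: "faces K = {X. X \<subseteq> vertices K \<and> independent_columns {..<m} M X}"
    by (auto simp: BRSC_def boolean_representable_def)
  have "?chain X" if X: "X \<in> faces K" for X
  proof -
    from X K obtain Y n r c where Y: "Y \<subseteq> {..<m}" and r: "bij_betw r {..<n} Y"
      and c: "bij_betw c {..<n} X" and tri: "lower_unitriangular n (\<lambda>i j. M (r i) (c j))"
      and XV: "X \<subseteq> vertices K"
      by (auto simp: independent_columns_def nonsingular_submatrix_def)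
    define F where "F i = {v \<in> vertices K. \<forall>j<n - i. \<not> M (r j) v}" for i
    define x where "x = (\<lambda>i. c (n - i))"
    have rm: "r j < m" if "j < n" for j using that r Y by (auto simp: bij_betw_def)
    have fl: "flat K {v \<in> vertices K. \<forall>j<l. \<not> M (r j) v}" if "l \<le> n" for l
      using that
    proof (induction l)
      case 0
      then show ?case using flat_vertices[of K] by simp
    next
      case (Suc l)
      have "{v \<in> vertices K. \<forall>j<Suc l. \<not> M (r j) v} =
        {v \<in> vertices K. \<forall>j<l. \<not> M (r j) v} \<inter> {v \<in> vertices K. \<not> M (r l) v}"
        by (auto simp: less_Suc_eq)
      then show ?case
        using flat_Int[OF Suc.IH flat_zero_columns[OF K rm[of l]]] Suc.prems by simp
    qed
    have x: "bij_betw x {1..n} X"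
    proof -
      have "bij_betw (\<lambda>i. n - i) {1..n} {..<n}"
        by (rule bij_betw_byWitness[where f' = "\<lambda>i. n - i"]) auto
      from bij_betw_trans[OF this c] show ?thesis by (simp add: x_def comp_def)
    qed
    have step: "F (i - 1) \<subset> F i \<and> x i \<in> F i - F (i - 1)" if i: "i \<in> {1..n}" for i
    proof -
      have lt: "n - i < n - (i - 1)" "n - i < n" using i by auto
      have "x i \<in> X" using x i by (auto simp: bij_betw_def)
      then have "x i \<in> F i - F (i - 1)"
        using XV tri lt unfolding F_def x_def lower_unitriangular_def by auto
      moreover have "F (i - 1) \<subseteq> F i" unfolding F_def using lt by auto
      ultimately show ?thesis by blast
    qed
    have "\<forall>i\<le>n. flat K (F i)" using fl by (simp add: F_def)
    moreover have "\<forall>i\<in>{1..n}. F (i - 1) \<subset> F i \<and> x i \<in> F i - F (i - 1)"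
      using step by (intro ballI)
    ultimately show ?thesis using x by (intro exI conjI)
  qed
  with sc show "simplicial_complex K \<and> (\<forall>X\<in>faces K. ?chain X)" by blast
next
  assume "simplicial_complex K \<and> (\<forall>X\<in>faces K. ?chain X)"
  then have sc: "simplicial_complex K" and ch: "\<And>X. X \<in> faces K \<Longrightarrow> ?chain X" by blast+
  have V: "finite (vertices K)" and FV: "faces K \<subseteq> Pow (vertices K)"
    using sc by (auto simp: simplicial_complex_def)
  have empty: "{} \<in> faces K" using sc unfolding simplicial_complex_def by blast
  have "finite {F. flat K F}"
    by (rule finite_subset[of _ "Pow (vertices K)"]) (auto simp: flat_def V)
  then obtain e where e: "bij_betw e {..<card {F. flat K F}} {F. flat K F}"
    using ex_bij_betw_nat_finite by (metis lessThan_atLeast0)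
  define m where "m = card {F. flat K F}"
  define M where "M = (\<lambda>s v. v \<notin> e s)"
  have e: "bij_betw e {..<m} {F. flat K F}" using e by (simp add: m_def)
  have "X \<in> faces K \<longleftrightarrow> X \<subseteq> vertices K \<and> independent_columns {..<m} M X" for X
  proof
    assume X: "X \<in> faces K"
    from ch[OF X] obtain k :: nat and x F where x: "bij_betw x {1..k} X"
      and F: "\<And>i. i \<le> k \<Longrightarrow> flat K (F i)"
      and ss: "\<And>i. i \<in> {1..k} \<Longrightarrow> F (i - 1) \<subset> F i"
      and xF: "\<And>i. i \<in> {1..k} \<Longrightarrow> x i \<in> F i - F (i - 1)" by blast
    have mono: "F i \<subset> F j" if "i < j" "j \<le> k" for i j
      using that
    proof (induction j)
      case (Suc j)
      have "F j \<subset> F (Suc j)" using ss[of "Suc j"] Suc.prems by simp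
      then show ?case using Suc by (cases "i = j") auto
    qed simp
    define r where "r i = the_inv_into {..<m} e (F (k - Suc i))" for i
    define c where "c = (\<lambda>i. x (k - i))"
    have inj: "inj_on e {..<m}" and img: "e ` {..<m} = {F. flat K F}"
      using e by (auto simp: bij_betw_def)
    have er: "e (r i) = F (k - Suc i)" for i
      unfolding r_def by (rule f_the_inv_into_f[OF inj]) (simp add: img F)
    have rm: "r i \<in> {..<m}" for i
      unfolding r_def by (rule the_inv_into_into[OF inj _ subset_refl]) (simp add: img F)
    have "bij_betw c {..<k} X"
    proof -
      have "bij_betw (\<lambda>i. k - i) {..<k} {1..k}"
        by (rule bij_betw_byWitness[where f' = "\<lambda>i. k - i"]) auto
      from bij_betw_trans[OF this x] show ?thesis by (simp add: c_def comp_def)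
    qed
    moreover have "inj_on r {..<k}"
    proof (rule linorder_inj_onI)
      fix i j assume "i < j" "i \<in> {..<k}" "j \<in> {..<k}"
      then have "F (k - Suc j) \<subset> F (k - Suc i)" by (intro mono) auto
      then show "r i \<noteq> r j" using er[of i] er[of j] by auto
    qed auto
    moreover have "lower_unitriangular k (\<lambda>i j. M (r i) (c j))"
      unfolding lower_unitriangular_def
    proof (intro conjI allI impI)
      fix i assume "i < k"
      then show "M (r i) (c i)" using xF[of "k - i"] by (simp add: M_def er c_def)
    next
      fix i j assume ij: "i < k" "j < k" "i < j"
      have "F (k - j) \<subseteq> F (k - Suc i)"
      proof (cases "j = Suc i")
        case False
        then have "k - j < k - Suc i" using ij by linarith
        from mono[OF this] show ?thesis by auto
      qed simp
      then show "\<not> M (r i) (c j)" using xF[of "k - j"] ij by (auto simp: M_def er c_def)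
    qed
    ultimately have "nonsingular_submatrix M (r ` {..<k}) X"
      unfolding nonsingular_submatrix_def by (metis inj_on_imp_bij_betw)
    moreover have "r ` {..<k} \<subseteq> {..<m}" using rm by auto
    ultimately have "independent_columns {..<m} M X"
      unfolding independent_columns_def by (intro exI conjI)
    then show "X \<subseteq> vertices K \<and> independent_columns {..<m} M X" using X FV by blast
  next
    assume "X \<subseteq> vertices K \<and> independent_columns {..<m} M X"
    then obtain Y n r c where Y: "Y \<subseteq> {..<m}" and r: "bij_betw r {..<n} Y"
      and c: "bij_betw c {..<n} X" and tri: "lower_unitriangular n (\<lambda>i j. M (r i) (c j))"
      and XV: "X \<subseteq> vertices K"
      by (auto simp: independent_columns_def nonsingular_submatrix_def)
    show "X \<in> faces K"
    proof (rule face_of_flat_chain_independent[OF c empty XV, where Z = "\<lambda>i. e (r i)"])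
      show "flat K (e (r i))" if "i < n" for i
        using that e r Y by (auto simp: bij_betw_def)
    qed (use tri in \<open>auto simp: lower_unitriangular_def M_def\<close>)
  qed
  then have "faces K = {X. X \<subseteq> vertices K \<and> independent_columns {..<m} M X}" by auto
  then have "boolean_representable K"
    unfolding boolean_representable_def by (intro exI)
  with sc show "BRSC K" by (simp add: BRSC_def)
qed

end

theory Submission
  imports Defs
begin

text \<open>
  Let \<open>r\<close> be the largest size of a face of the truncation. Two vertices span an edge iff some
  flat separates them, so the 1-skeleton is complete multipartite; hence for \<open>r \<le> 2\<close> the
  truncation to rank \<open>r\<close> is already pure. For \<open>r = 3\<close> call a proper flat containing an edge a
  line. Every vertex lies in a triangle, and an edge lies in no triangle iff neither of its
  endpoints lies on a line. Thus passing to the pure part merges all classes of the multipartite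
  graph that avoid the lines into a single class. The lines, the new classes and the empty set
  generate a boolean representable complex whose 3-truncation is the pure part.
\<close>

section \<open>Complexes generated by a family of sets\<close>

text \<open>When the members of \<open>\<F>\<close> lie in \<open>V\<close>, these are the
  independent column sets of the boolean matrix whose rows are the complements of the members of
  \<open>\<F>\<close>. The family need not be closed under intersection.\<close>

inductive_set generated_faces :: "'a set \<Rightarrow> 'a set set \<Rightarrow> 'a set set" for V \<F> where
  empty: "{} \<in> generated_faces V \<F>"
| extend: "X \<in> generated_faces V \<F> \<Longrightarrow> F \<in> \<F> \<Longrightarrow> X \<subseteq> F \<Longrightarrow> p \<in> V - F \<Longrightarrow>
    insert p X \<in> generated_faces V \<F>"

text \<open>Dropping vertices from a generating sequence leaves one: the set used at a step still
  contains the fewer vertices added before it.\<close>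

lemma generated_faces_subset:
  assumes "X \<in> generated_faces V \<F>" and "Y \<subseteq> X"
  shows "Y \<in> generated_faces V \<F>"
  using assms
proof (induction arbitrary: Y)
  case empty
  then show ?case by (simp add: generated_faces.empty)
next
  case (extend X F p)
  show ?case
  proof (cases "p \<in> Y")
    case True
    have "insert p (Y - {p}) \<in> generated_faces V \<F>"
      by (rule generated_faces.extend[OF extend.IH extend.hyps(2)]) (use extend in auto)
    then show ?thesis using True by (simp add: insert_absorb)
  next
    case False
    then show ?thesis using extend by blast
  qed
qed

lemma generated_faces_Pow:
  "X \<in> generated_faces V \<F> \<Longrightarrow> X \<subseteq> V"
  by (induction rule: generated_faces.induct) auto

lemma generated_faces_cases:
  assumes "X \<in> generated_faces V \<F>" and "X \<noteq> {}"
  obtains p F where "p \<in> X" "F \<in> \<F>" "X - {p} \<subseteq> F" "p \<notin> F"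
  using assms by (cases rule: generated_faces.cases) auto

lemma flat_generated_faces:
  assumes "F \<in> \<F>" and "F \<subseteq> V"
  shows "flat (V, generated_faces V \<F>) F"
  using assms by (auto simp: flat_def intro: generated_faces.extend)

text \<open>The empty member makes singletons faces. Chains of flats are built along the generation,
  since members of \<open>\<F>\<close> are flats and flats are closed under intersection.\<close>

lemma BRSC_generated_faces:
  assumes V: "finite V" "V \<noteq> {}" and \<F>: "{} \<in> \<F>" "\<And>F. F \<in> \<F> \<Longrightarrow> F \<subseteq> V"
  shows "BRSC (V, generated_faces V \<F>)"
proof -
  let ?B = "(V, generated_faces V \<F>)"
  have "{v} \<in> generated_faces V \<F>" if "v \<in> V" for v
    using generated_faces.extend[OF generated_faces.empty \<F>(1), of v] that by simp
  then have "simplicial_complex ?B"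
    using V by (auto simp: simplicial_complex_def
        intro: generated_faces_subset dest: generated_faces_Pow[THEN subsetD])
  moreover have "\<exists>(k::nat) x F. bij_betw x {1..k} X \<and> (\<forall>i\<le>k. flat ?B (F i)) \<and>
      (\<forall>i\<in>{1..k}. F (i - 1) \<subset> F i \<and> x i \<in> F i - F (i - 1))"
    if "X \<in> generated_faces V \<F>" for X
    using that
  proof induction
    case empty
    have "flat ?B V" using flat_vertices[of ?B] by simp
    then show ?case
      by (intro exI[of _ 0] exI[of _ "\<lambda>_. undefined"] exI[of _ "\<lambda>_::nat. V"]) (simp add: bij_betw_def)
  next
    case (extend X G p)
    then obtain k :: nat and x F where x: "bij_betw x {1..k} X"
      and F: "\<And>i. i \<le> k \<Longrightarrow> flat ?B (F i)"
      and step: "\<And>i. i \<in> {1..k} \<Longrightarrow> F (i - 1) \<subset> F i \<and> x i \<in> F i - F (i - 1)" by blast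
    define x' where "x' = x(Suc k := p)"
    \<comment> \<open>Cutting the old chain down to \<open>G\<close> keeps \<open>p\<close> out of
      it, and \<open>V\<close> goes on top. The inclusions stay strict because every
      \<open>x i\<close> lies in \<open>X\<close> and hence in \<open>G\<close>.\<close>
    define F' where "F' i = (if i \<le> k then F i \<inter> G else V)" for i
    have G: "flat ?B G" using extend.hyps \<F> by (intro flat_generated_faces) auto
    have pX: "p \<notin> X" using extend.hyps by blast
    have xX: "x i \<in> X" if "i \<in> {1..k}" for i using x that by (auto simp: bij_betw_def)
    have "bij_betw x' {1..Suc k} (insert p X)"
    proof -
      have "bij_betw x' {1..k} X"
        using x by (subst bij_betw_cong[of _ _ x]) (auto simp: x'_def)
      then have "bij_betw x' ({1..k} \<union> {Suc k}) (X \<union> {x' (Suc k)})"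
        by (rule notIn_Un_bij_betw[rotated 2]) (auto simp: x'_def pX)
      moreover have "{1..k} \<union> {Suc k} = {1..Suc k}" by auto
      ultimately show ?thesis by (simp add: x'_def)
    qed
    moreover have "\<forall>i\<le>Suc k. flat ?B (F' i)"
      using F G flat_vertices[of ?B] by (auto simp: F'_def intro: flat_Int)
    moreover have "\<forall>i\<in>{1..Suc k}. F' (i - 1) \<subset> F' i \<and> x' i \<in> F' i - F' (i - 1)"
    proof
      fix i assume i: "i \<in> {1..Suc k}"
      show "F' (i - 1) \<subset> F' i \<and> x' i \<in> F' i - F' (i - 1)"
      proof (cases "i = Suc k")
        case True
        then show ?thesis
          using extend.hyps \<F>(2)[of G] by (auto simp: F'_def x'_def)
      next
        case False
        then have i: "i \<in> {1..k}" using i by auto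
        then have "x i \<in> G" using xX extend.hyps by blast
        then show ?thesis using step[OF i] i by (auto simp: F'_def x'_def)
      qed
    qed
    ultimately show ?case by (intro exI conjI)
  qed
  ultimately show ?thesis unfolding BRSC_iff_chains_of_flats by simp
qed

section \<open>Faces of a boolean representable complex\<close>

lemma simplicial_complex_face:
  assumes "simplicial_complex K" and "X \<in> faces K"
  shows "X \<subseteq> vertices K" and "Y \<subseteq> X \<Longrightarrow> Y \<in> faces K" and "finite X"
  using assms finite_subset[of X "vertices K"] by (auto simp: simplicial_complex_def)

lemma flat_extend:
  "flat K F \<Longrightarrow> X \<in> faces K \<Longrightarrow> X \<subseteq> F \<Longrightarrow> p \<in> vertices K - F \<Longrightarrow> insert p X \<in> faces K"
  by (simp add: flat_def)

text \<open>The last vertex of the enumeration serves as \<open>p\<close>; the last flat but one of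
  the chain contains all earlier vertices. This mirrors
  \<open>generated_faces_cases\<close>.\<close>

lemma BRSC_face_cases:
  assumes "BRSC K" and "X \<in> faces K" and "X \<noteq> {}"
  obtains p F where "p \<in> X" "flat K F" "X - {p} \<subseteq> F" "p \<notin> F"
proof -
  obtain k :: nat and x F where x: "bij_betw x {1..k} X"
    and F: "\<And>i. i \<le> k \<Longrightarrow> flat K (F i)"
    and step: "\<And>i. i \<in> {1..k} \<Longrightarrow> F (i - 1) \<subset> F i \<and> x i \<in> F i - F (i - 1)"
    using assms unfolding BRSC_iff_chains_of_flats by blast
  have k: "k \<ge> 1" using x assms(3) by (cases k) (auto simp: bij_betw_def)
  have mono: "F i \<subseteq> F j" if "i \<le> j" "j \<le> k" for i j
    using that
  proof (induction j rule: dec_induct)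
    case (step j)
    then show ?case using \<open>\<And>i. i \<in> {1..k} \<Longrightarrow> _\<close>[of "Suc j"] by auto
  qed simp
  have "X - {x k} \<subseteq> F (k - 1)"
  proof
    fix y assume y: "y \<in> X - {x k}"
    then obtain i where i: "i \<in> {1..k}" "y = x i" using x by (auto simp: bij_betw_def)
    with y have "i \<le> k - 1" by (cases "i = k") auto
    then show "y \<in> F (k - 1)" using step[OF i(1)] mono[of i "k - 1"] i by auto
  qed
  moreover have "x k \<in> X" using x k by (auto simp: bij_betw_def)
  ultimately show thesis using that[of "x k" "F (k - 1)"] F[of "k - 1"] step[of k] k by auto
qed

section \<open>Edges and triangles in terms of flats\<close>

definition separated :: "'a scomplex \<Rightarrow> 'a \<Rightarrow> 'a \<Rightarrow> bool" where
  "separated K a b \<longleftrightarrow> (\<exists>F. flat K F \<and> (a \<in> F) \<noteq> (b \<in> F))"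

lemma separated_sym: "separated K a b \<longleftrightarrow> separated K b a"
  unfolding separated_def by metis

text \<open>Contrapositive of transitivity of lying in the same flats; this is what makes the graph
  of edges complete multipartite.\<close>

lemma separated_cotrans: "separated K a b \<Longrightarrow> separated K a c \<or> separated K c b"
  unfolding separated_def by metis

lemma edge_iff_separated:
  assumes K: "BRSC K" and V: "a \<in> vertices K" "b \<in> vertices K" and "a \<noteq> b"
  shows "{a, b} \<in> faces K \<longleftrightarrow> separated K a b"
proof
  assume "{a, b} \<in> faces K"
  from BRSC_face_cases[OF K this] obtain p F
    where "p \<in> {a, b}" "flat K F" "{a, b} - {p} \<subseteq> F" "p \<notin> F" by blast
  then show "separated K a b" unfolding separated_def using \<open>a \<noteq> b\<close> by auto
next
  have sing: "{v} \<in> faces K" if "v \<in> vertices K" for v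
    using K that by (auto simp: BRSC_def simplicial_complex_def)
  assume "separated K a b"
  then obtain F where "flat K F" "a \<in> F \<and> b \<notin> F \<or> b \<in> F \<and> a \<notin> F"
    unfolding separated_def by blast
  then have "{a} \<union> {b} \<in> faces K \<or> {b} \<union> {a} \<in> faces K"
    using sing[OF V(1)] sing[OF V(2)] V unfolding flat_def by blast
  then show "{a, b} \<in> faces K" by (auto simp: insert_commute)
qed

text \<open>Splitting off the last vertex leaves an edge inside a flat that misses \<open>p\<close>.
  \<open>triangleI\<close> is the converse.\<close>

lemma triangle_cases:
  assumes K: "BRSC K" and X: "X \<in> faces K" "card X = 3"
  obtains a b p F where "X = {a, b, p}" "a \<noteq> b" "a \<noteq> p" "b \<noteq> p" "{a, b} \<subseteq> vertices K"
    "p \<in> vertices K - F" "flat K F" "a \<in> F" "b \<in> F" "separated K a b"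
proof -
  have "X \<noteq> {}" using X by auto
  from BRSC_face_cases[OF K X(1) this] obtain p F
    where p: "p \<in> X" "flat K F" "X - {p} \<subseteq> F" "p \<notin> F" .
  have sc: "simplicial_complex K" using K by (simp add: BRSC_def)
  have "card (X - {p}) = 2" using X p by simp
  then obtain a b where ab: "X - {p} = {a, b}" "a \<noteq> b" by (auto simp: card_2_iff)
  have V: "X \<subseteq> vertices K" and "X - {p} \<in> faces K"
    using simplicial_complex_face[OF sc X(1)] by auto
  moreover have "a \<in> X" "b \<in> X" "a \<noteq> p" "b \<noteq> p" using ab(1) by auto
  ultimately have "separated K a b"
    using edge_iff_separated[OF K, of a b] ab by auto
  moreover have "X = {a, b, p}" using ab(1) p(1) by auto
  ultimately show thesis
    using that[of a b p F] V p ab \<open>a \<noteq> p\<close> \<open>b \<noteq> p\<close> by auto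
qed

lemma triangleI:
  assumes K: "BRSC K" and F: "flat K F" and ab: "a \<in> F" "b \<in> F" "separated K a b"
    and p: "p \<in> vertices K - F"
  shows "{a, b, p} \<in> faces K" and "card {a, b, p} = 3"
proof -
  have V: "a \<in> vertices K" "b \<in> vertices K" using F ab by (auto simp: flat_def)
  have ne: "a \<noteq> b" using ab(3) by (auto simp: separated_def)
  have "{a, b} \<in> faces K" using edge_iff_separated[OF K V ne] ab by simp
  from flat_extend[OF F this _ p] show "{a, b, p} \<in> faces K"
    using ab by (simp add: insert_commute)
  have "a \<noteq> p" "b \<noteq> p" using ab p by auto
  then show "card {a, b, p} = 3" using ne by simp
qed

section \<open>Lines and the edges that lie in triangles\<close>

definition lines :: "'a scomplex \<Rightarrow> 'a set set" where
  "lines K = {F. flat K F \<and> F \<noteq> vertices K \<and> (\<exists>a\<in>F. \<exists>b\<in>F. separated K a b)}"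

text \<open>The edges of the pure part; non-adjacency merges all classes that meet no line.\<close>

definition linked :: "'a scomplex \<Rightarrow> 'a \<Rightarrow> 'a \<Rightarrow> bool" where
  "linked K a b \<longleftrightarrow> separated K a b \<and> (a \<in> \<Union>(lines K) \<or> b \<in> \<Union>(lines K))"

lemma not_linked_refl: "\<not> linked K a a"
  by (simp add: linked_def separated_def)

lemma linked_sym: "linked K a b \<longleftrightarrow> linked K b a"
  using separated_sym[of K a b] by (auto simp: linked_def)

text \<open>A line through \<open>a\<close> misses \<open>b\<close>, so it is itself the separating
  flat.\<close>

lemma lines_separated: "a \<in> \<Union>(lines K) \<Longrightarrow> b \<notin> \<Union>(lines K) \<Longrightarrow> separated K a b"
  unfolding separated_def lines_def by blast

text \<open>Say \<open>a\<close> lies on a line. If \<open>c\<close> lies on no line, then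
  \<open>a\<close> and \<open>c\<close> are separated by \<open>lines_separated\<close>, hence
  linked. Otherwise both pairs meet a line, and cotransitivity of \<open>separated\<close>
  suffices.\<close>

lemma linked_cotrans:
  assumes "linked K a b"
  shows "linked K a c \<or> linked K c b"
  using assms separated_cotrans[of K a b c] lines_separated[of _ K]
    separated_sym[of K] unfolding linked_def by metis

text \<open>A line contains a separated pair, and by cotransitivity \<open>a\<close> is separated
  from one of its two members.\<close>

lemma separated_of_line:
  assumes "F \<in> lines K"
  obtains c where "c \<in> F" "separated K a c"
  using assms separated_cotrans[of K _ _ a] separated_sym[of K] unfolding lines_def by blast

text \<open>Take a line through one endpoint. If it contains the other, any vertex off the line
  completes the triangle; if not, a vertex of the line separated from the first endpoint
  does.\<close>

lemma linked_in_triangle: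
  assumes K: "BRSC K" and V: "a \<in> vertices K" "b \<in> vertices K" and ab: "linked K a b"
  obtains X where "X \<in> faces K" "card X = 3" "a \<in> X" "b \<in> X"
proof -
  have *: "\<exists>X\<in>faces K. card X = 3 \<and> a \<in> X \<and> b \<in> X"
    if F: "F \<in> lines K" "a \<in> F" and V: "b \<in> vertices K" and s: "separated K a b" for a b F
  proof (cases "b \<in> F")
    case True
    have F': "flat K F" "F \<noteq> vertices K" using F by (auto simp: lines_def)
    then obtain p where "p \<in> vertices K - F" by (auto simp: flat_def)
    from triangleI[OF K F'(1) F(2) True s this] show ?thesis by blast
  next
    case False
    obtain c where c: "c \<in> F" "separated K a c" using separated_of_line[OF F(1)] .
    have "flat K F" using F by (auto simp: lines_def)
    from triangleI[OF K this F(2) c] False V show ?thesis by blast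
  qed
  have "\<exists>X\<in>faces K. card X = 3 \<and> a \<in> X \<and> b \<in> X"
    using ab *[of _ a b] *[of _ b a] V separated_sym[of K a b] unfolding linked_def by blast
  then show thesis using that by blast
qed

section \<open>Truncations and their pure parts\<close>

lemma truncation_simplicial_complex:
  assumes "simplicial_complex K" and "1 \<le> m"
  shows "simplicial_complex (truncation m K)"
proof -
  have "card Y \<le> m" if "X \<subseteq> vertices K" "card X \<le> m" "Y \<subseteq> X" for X Y
  proof -
    have "finite X" using that assms by (auto simp: simplicial_complex_def intro: finite_subset)
    then show ?thesis using card_mono[OF _ that(3)] that(2) by linarith
  qed
  then show ?thesis using assms unfolding simplicial_complex_def truncation_def
    by (auto 0 3)
qed

lemma TBRSC_truncation:
  assumes "BRSC B" and "1 \<le> m"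
  shows "TBRSC (truncation m B)"
  unfolding TBRSC_def using assms truncation_simplicial_complex[of B m]
  by (metis BRSC_def)

text \<open>The pure part with the face size as a parameter, read off \<open>K\<close> itself so
  that the truncation disappears.\<close>

definition top_faces :: "nat \<Rightarrow> 'a scomplex \<Rightarrow> 'a scomplex" where
  "top_faces r K = (\<Union>{X \<in> faces K. card X = r}, {Y. \<exists>X\<in>faces K. card X = r \<and> Y \<subseteq> X})"

text \<open>The size \<open>r\<close> is that of the largest faces of the truncation, and may be
  below \<open>k\<close> if \<open>K\<close> has small dimension. Since \<open>r \<le> k\<close>,
  truncating loses no face of size \<open>r\<close>.\<close>

lemma pure_truncation:
  assumes K: "simplicial_complex K" and k: "1 \<le> k"
  obtains r where "1 \<le> r" "r \<le> k" "\<exists>X\<in>faces K. card X = r"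
    "pure (truncation k K) = top_faces r K"
proof -
  let ?T = "truncation k K"
  define r where "r = Max (card ` faces ?T)"
  have T: "simplicial_complex ?T" using truncation_simplicial_complex[OF K k] .
  then have fin: "finite (card ` faces ?T)"
    unfolding simplicial_complex_def by (metis finite_Pow_iff finite_imageI finite_subset)
  obtain v where "{v} \<in> faces ?T" using T by (auto simp: simplicial_complex_def)
  then have one: "1 \<in> card ` faces ?T" by force
  then have r1: "1 \<le> r" unfolding r_def using fin by simp
  have "r \<in> card ` faces ?T" unfolding r_def using Max_in[OF fin] one by blast
  then obtain X where X: "X \<in> faces ?T" "card X = r" by auto
  then have rk: "r \<le> k" and ex: "\<exists>X\<in>faces K. card X = r" by (auto simp: truncation_def)
  \<comment> \<open>The truncated subtraction in \<open>dimension\<close> is undone because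
    \<open>r\<close> is at least 1.\<close>
  have dim: "dimension ?T + 1 = r" using r1 by (simp add: dimension_def r_def)
  have "{X \<in> faces ?T. card X = r} = {X \<in> faces K. card X = r}"
    using rk K by (auto simp: truncation_def simplicial_complex_def)
  then have "pure ?T = top_faces r K" unfolding pure_def Let_def dim top_faces_def by auto
  then show thesis using that r1 rk ex by blast
qed

section \<open>Ranks one and two\<close>

lemma top_faces_1:
  assumes K: "simplicial_complex K"
  shows "top_faces 1 K = truncation 1 K"
proof -
  have sing: "\<And>v. v \<in> vertices K \<Longrightarrow> {v} \<in> faces K" and "vertices K \<noteq> {}"
    using K by (auto simp: simplicial_complex_def)
  then have empty: "{} \<in> faces K" using simplicial_complex_face(2)[OF K] by blast
  note FV = simplicial_complex_face(1)[OF K]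
  have one: "{X \<in> faces K. card X = 1} = (\<lambda>v. {v}) ` vertices K"
    using sing FV by (auto simp: card_1_singleton_iff)
  have "(\<exists>X\<in>faces K. card X = 1 \<and> Y \<subseteq> X) \<longleftrightarrow> Y \<in> faces K \<and> Y \<subseteq> vertices K \<and> card Y \<le> 1" for Y
  proof -
    have "(\<exists>X\<in>faces K. card X = 1 \<and> Y \<subseteq> X) \<longleftrightarrow> (\<exists>X\<in>{X \<in> faces K. card X = 1}. Y \<subseteq> X)"
      by blast
    also have "\<dots> \<longleftrightarrow> (\<exists>v\<in>vertices K. Y \<subseteq> {v})" unfolding one by blast
    also have "\<dots> \<longleftrightarrow> Y = {} \<or> (\<exists>v\<in>vertices K. Y = {v})"
      using \<open>vertices K \<noteq> {}\<close> by auto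
    also have "\<dots> \<longleftrightarrow> Y \<in> faces K \<and> Y \<subseteq> vertices K \<and> card Y \<le> 1"
    proof
      assume Y: "Y \<in> faces K \<and> Y \<subseteq> vertices K \<and> card Y \<le> 1"
      then have "finite Y" using simplicial_complex_face(3)[OF K] by blast
      then show "Y = {} \<or> (\<exists>v\<in>vertices K. Y = {v})"
        using Y by (cases "card Y") (auto simp: card_1_singleton_iff le_Suc_eq)
    qed (use sing empty in auto)
    finally show ?thesis .
  qed
  moreover have "\<Union>{X \<in> faces K. card X = 1} = vertices K" unfolding one by auto
  ultimately show ?thesis unfolding top_faces_def truncation_def by auto
qed

text \<open>One edge suffices for purity: by cotransitivity every vertex is separated from one of
  its ends, so no vertex is isolated.\<close>

lemma top_faces_2:
  assumes K: "BRSC K" and ex: "\<exists>X\<in>faces K. card X = 2"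
  shows "top_faces 2 K = truncation 2 K"
proof -
  have sc: "simplicial_complex K" using K by (simp add: BRSC_def)
  note FV = simplicial_complex_face(1)[OF sc] and sub = simplicial_complex_face(2)[OF sc]
  obtain a b where ab: "{a, b} \<in> faces K" "a \<noteq> b" using ex by (auto simp: card_2_iff)
  then have V: "a \<in> vertices K" "b \<in> vertices K" using FV by auto
  have s: "separated K a b" using edge_iff_separated[OF K V ab(2)] ab by simp
  have cover: "\<exists>X\<in>faces K. card X = 2 \<and> v \<in> X" if v: "v \<in> vertices K" for v
  proof -
    obtain w where w: "w \<in> vertices K" "separated K v w"
      using separated_cotrans[OF s, of v] V separated_sym[of K] by blast
    then have "v \<noteq> w" by (auto simp: separated_def)
    then show ?thesis
      using edge_iff_separated[OF K v w(1)] w by (intro bexI[of _ "{v, w}"]) auto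
  qed
  have up: "\<exists>X\<in>faces K. card X = 2 \<and> Y \<subseteq> X" if Y: "Y \<in> faces K" "card Y \<le> 2" for Y
  proof -
    have "finite Y" using simplicial_complex_face(3)[OF sc Y(1)] .
    consider "card Y = 0" | "card Y = 1" | "card Y = 2" using Y(2) by linarith
    then show ?thesis
    proof cases
      case 1
      then show ?thesis using \<open>finite Y\<close> ex by auto
    next
      case 2
      then obtain v where "Y = {v}" by (auto simp: card_1_singleton_iff)
      then show ?thesis using cover[of v] FV[OF Y(1)] by auto
    next
      case 3
      then show ?thesis using Y by blast
    qed
  qed
  \<comment> \<open>\<open>X\<close> is finite because \<open>card\<close> is 0 on infinite
    sets.\<close>
  have "card Y \<le> 2" if "X \<in> faces K" "card X = 2" "Y \<subseteq> X" for X Y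
    using card_mono[of X Y] that by (metis card.infinite zero_neq_numeral)
  then have "{Y. \<exists>X\<in>faces K. card X = 2 \<and> Y \<subseteq> X} \<subseteq>
      faces K \<inter> {X. X \<subseteq> vertices K \<and> card X \<le> 2}"
    by (auto intro: sub dest: FV[THEN subsetD])
  then have "{Y. \<exists>X\<in>faces K. card X = 2 \<and> Y \<subseteq> X} =
      faces K \<inter> {X. X \<subseteq> vertices K \<and> card X \<le> 2}"
    by (rule equalityI) (use up in auto)
  moreover have "\<Union>{X \<in> faces K. card X = 2} = vertices K" using cover FV by blast
  ultimately show ?thesis unfolding top_faces_def truncation_def by simp
qed

section \<open>Rank three\<close>

text \<open>The sets \<open>{w \<in> vertices K. \<not> linked K v w}\<close> are the classes of
  non-adjacency in the pure part. The empty set yields the vertices, the classes yield the edges,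
  and the lines yield the triangles.\<close>

definition line_family :: "'a scomplex \<Rightarrow> 'a set set" where
  "line_family K = insert {} (lines K \<union> (\<lambda>v. {w \<in> vertices K. \<not> linked K v w}) ` vertices K)"

lemma line_family_cases:
  assumes "F \<in> line_family K" and "a \<in> F"
  obtains "F \<in> lines K" | v where "v \<in> vertices K" "F = {w \<in> vertices K. \<not> linked K v w}"
  using assms unfolding line_family_def by blast

text \<open>Any member of the family containing just one endpoint links the two: a line separates
  them and passes through one of them, and a class separates only linked vertices, by
  \<open>linked_cotrans\<close>.\<close>

lemma linked_of_generated_edge:
  assumes ab: "{a, b} \<in> generated_faces (vertices K) (line_family K)" and ne: "a \<noteq> b"
  shows "linked K a b"
proof -
  have V: "a \<in> vertices K" "b \<in> vertices K" using generated_faces_Pow[OF ab] by auto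
  have *: "linked K c d"
    if F: "F \<in> line_family K" and cd: "c \<in> F" "d \<notin> F" and d: "d \<in> vertices K" for c d F
    using F cd(1)
  proof (cases rule: line_family_cases)
    case 1
    then show ?thesis using cd by (auto simp: linked_def lines_def separated_def)
  next
    case (2 v)
    then have "\<not> linked K v c" "linked K v d" using cd d by auto
    then show ?thesis using linked_cotrans[of K v d c] by blast
  qed
  obtain p F where "p \<in> {a, b}" "F \<in> line_family K" "{a, b} - {p} \<subseteq> F" "p \<notin> F"
    using generated_faces_cases[OF ab] by blast
  then show ?thesis
    using *[of F a b] *[of F b a] V ne linked_sym[of K a b] by blast
qed

text \<open>The set containing all but the last vertex contains a linked pair. A non-adjacency class
  contains none, so the set is a line and \<open>triangleI\<close> applies.\<close>

lemma generated_triangle_face: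
  assumes K: "BRSC K" and X: "X \<in> generated_faces (vertices K) (line_family K)" "card X = 3"
  shows "X \<in> faces K"
proof -
  have "X \<noteq> {}" using X(2) by auto
  from generated_faces_cases[OF X(1) this] obtain p F
    where p: "p \<in> X" "F \<in> line_family K" "X - {p} \<subseteq> F" "p \<notin> F" .
  have "card (X - {p}) = 2" using X p by simp
  then obtain a b where ab: "X - {p} = {a, b}" "a \<noteq> b" by (auto simp: card_2_iff)
  have "{a, b} \<in> generated_faces (vertices K) (line_family K)"
    using generated_faces_subset[OF X(1), of "{a, b}"] ab(1) by blast
  then have l: "linked K a b" using ab(2) by (rule linked_of_generated_edge)
  have abF: "a \<in> F" "b \<in> F" using p ab(1) by auto
  have pV: "p \<in> vertices K - F" using generated_faces_Pow[OF X(1)] p by auto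
  from p(2) abF(1) show ?thesis
  proof (cases rule: line_family_cases)
    case 1
    then have "{a, b, p} \<in> faces K"
      using triangleI(1)[OF K _ abF _ pV] l by (auto simp: lines_def linked_def)
    moreover have "X = {a, b, p}" using ab(1) p(1) by auto
    ultimately show ?thesis by simp
  next
    case (2 v)
    then have "\<not> linked K v a" "\<not> linked K v b" using abF by auto
    then show ?thesis using l linked_cotrans[of K a b v] linked_sym[of K] by blast
  qed
qed

text \<open>The flat through \<open>a\<close> and \<open>b\<close> that misses \<open>p\<close> is a
  line, so \<open>a\<close> and \<open>b\<close> are linked. The triangle is then generated in the
  order \<open>b\<close>, \<open>a\<close>, \<open>p\<close>.\<close>

lemma triangle_generated:
  assumes K: "BRSC K" and X: "X \<in> faces K" "card X = 3"
  shows "X \<in> generated_faces (vertices K) (line_family K)"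
proof -
  obtain a b p F where X_eq: "X = {a, b, p}" and ne: "a \<noteq> b" "a \<noteq> p" "b \<noteq> p"
    and V: "{a, b} \<subseteq> vertices K" and p: "p \<in> vertices K - F" and F: "flat K F"
    and ab: "a \<in> F" "b \<in> F" "separated K a b"
    using triangle_cases[OF K X] by metis
  let ?G = "generated_faces (vertices K) (line_family K)"
  have line: "F \<in> lines K" using F ab p by (auto simp: lines_def)
  then have l: "linked K b a" using ab separated_sym[of K a b] by (auto simp: linked_def)
  have "{b} \<in> ?G"
    using generated_faces.extend[OF generated_faces.empty, of "{}" "line_family K" b] V
    by (auto simp: line_family_def)
  \<comment> \<open>The class of \<open>b\<close> contains \<open>b\<close> but not its neighbour
    \<open>a\<close>.\<close>
  then have "{a, b} \<in> ?G"
    by (rule generated_faces.extend[where F = "{w \<in> vertices K. \<not> linked K b w}"])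
      (use V l not_linked_refl[of K b] in \<open>auto simp: line_family_def\<close>)
  then have "insert p {a, b} \<in> ?G"
    by (rule generated_faces.extend[where F = F])
      (use line ab p in \<open>auto simp: line_family_def\<close>)
  then show ?thesis by (simp add: X_eq insert_commute)
qed

text \<open>Both complexes have the same triangles. Generated edges are linked and so lie in
  triangles of \<open>K\<close>; every vertex is linked to an end of one fixed linked edge, so it
  lies in a triangle too.\<close>

lemma top_faces_3:
  assumes K: "BRSC K" and ex: "\<exists>X\<in>faces K. card X = 3"
  shows "top_faces 3 K =
    truncation 3 (vertices K, generated_faces (vertices K) (line_family K))"
proof -
  let ?G = "generated_faces (vertices K) (line_family K)"
  have sc: "simplicial_complex K" and fin: "finite (vertices K)"
    using K by (auto simp: BRSC_def simplicial_complex_def)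
  note FV = simplicial_complex_face(1)[OF sc]
  obtain X where "X \<in> faces K" "card X = 3" using ex by blast
  from triangle_cases[OF K this] obtain a b p F where
    F: "flat K F" "a \<in> F" "b \<in> F" "separated K a b" "p \<in> vertices K - F" by metis
  have ab: "linked K a b" and V: "a \<in> vertices K" "b \<in> vertices K"
    using F by (auto simp: linked_def lines_def flat_def)
  have cover: "\<exists>X\<in>faces K. card X = 3 \<and> v \<in> X" if v: "v \<in> vertices K" for v
  proof -
    obtain w where w: "w \<in> vertices K" "linked K v w"
      using linked_cotrans[OF ab, of v] V linked_sym[of K] by blast
    show ?thesis using linked_in_triangle[OF K v w] by blast
  qed
  have up: "\<exists>X\<in>faces K. card X = 3 \<and> Y \<subseteq> X" if Y: "Y \<in> ?G" "card Y \<le> 3" for Y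
  proof -
    have YV: "Y \<subseteq> vertices K" using generated_faces_Pow[OF Y(1)] .
    then have "finite Y" using fin finite_subset by blast
    consider "card Y = 0" | "card Y = 1" | "card Y = 2" | "card Y = 3" using Y(2) by linarith
    then show ?thesis
    proof cases
      case 1
      then show ?thesis using \<open>finite Y\<close> ex by auto
    next
      case 2
      then obtain v where "Y = {v}" by (auto simp: card_1_singleton_iff)
      then show ?thesis using cover[of v] YV by auto
    next
      case 3
      then obtain c d where cd: "Y = {c, d}" "c \<noteq> d" by (auto simp: card_2_iff)
      then have "linked K c d" using Y(1) by (intro linked_of_generated_edge) simp_all
      moreover have "c \<in> vertices K" "d \<in> vertices K" using YV cd(1) by auto
      ultimately obtain X where "X \<in> faces K" "card X = 3" "c \<in> X" "d \<in> X"
        using linked_in_triangle[OF K] by metis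
      then show ?thesis using cd(1) by auto
    next
      case 4
      then show ?thesis using generated_triangle_face[OF K Y(1)] by blast
    qed
  qed
  have "card Y \<le> 3" if "X \<in> faces K" "card X = 3" "Y \<subseteq> X" for X Y
    using card_mono[of X Y] that by (metis card.infinite zero_neq_numeral)
  moreover have "Y \<in> ?G" if "X \<in> faces K" "card X = 3" "Y \<subseteq> X" for X Y
    using generated_faces_subset[OF triangle_generated[OF K that(1,2)] that(3)] .
  ultimately have "{Y. \<exists>X\<in>faces K. card X = 3 \<and> Y \<subseteq> X} \<subseteq>
      ?G \<inter> {X. X \<subseteq> vertices K \<and> card X \<le> 3}"
    by (auto dest: FV[THEN subsetD])
  then have "{Y. \<exists>X\<in>faces K. card X = 3 \<and> Y \<subseteq> X} =
      ?G \<inter> {X. X \<subseteq> vertices K \<and> card X \<le> 3}"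
    by (rule equalityI) (use up in auto)
  moreover have "\<Union>{X \<in> faces K. card X = 3} = vertices K" using cover FV by blast
  ultimately show ?thesis unfolding top_faces_def truncation_def by simp
qed

lemma BRSC_line_family:
  assumes "BRSC K"
  shows "BRSC (vertices K, generated_faces (vertices K) (line_family K))"
  using assms by (intro BRSC_generated_faces)
    (auto simp: BRSC_def simplicial_complex_def line_family_def lines_def flat_def)

theorem theorem7p15:
  fixes K :: "'a scomplex" and k :: nat
  assumes "BRSC K" and "1 \<le> k" and "k \<le> 3"
  shows "TBRSC (pure (truncation k K))"
proof -
  have sc: "simplicial_complex K" using assms(1) by (simp add: BRSC_def)
  obtain r where r: "1 \<le> r" "r \<le> k" "\<exists>X\<in>faces K. card X = r"
    and p: "pure (truncation k K) = top_faces r K"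
    using pure_truncation[OF sc assms(2)] by blast
  \<comment> \<open>For \<open>r \<le> 2\<close> the complex \<open>K\<close> itself is truncated;
    for \<open>r = 3\<close> it is replaced by the complex generated by
    \<open>line_family K\<close>.\<close>
  consider "r = 1" | "r = 2" | "r = 3" using r assms(3) by linarith
  then show ?thesis
  proof cases
    case 1
    then show ?thesis using p top_faces_1[OF sc] TBRSC_truncation[OF assms(1)] by simp
  next
    case 2
    then show ?thesis using p r top_faces_2[OF assms(1)] TBRSC_truncation[OF assms(1)] by simp
  next
    case 3
    then show ?thesis
      using p r top_faces_3[OF assms(1)] TBRSC_truncation[OF BRSC_line_family[OF assms(1)]]
      by simp
  qed
qed

end
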